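(* Let $n\geqslant 2$ and $d, r\geqslant 0$ be three integers with $0\leqslant r\leqslant (n-1)d$. Then $$m_e\left(K_n^d, r\right) = \sum_{i_1=0}^{r-1}\ \sum_{i_2=0}^{r-i_1-1} \cdots \sum_{i_{n-1}=0}^{r-i_1-\cdots-i_{n-2}-1} (r-i_1-\cdots-i_{n-1})\binom{d}{i_1}\binom{i_1}{i_2}\cdots \binom{i_{n-2}}{i_{n-1}}.$$
   Context: All graphs are finite, undirected, without loops or multiple edges. $K_n$ is the complete graph on $n$ vertices. The Cartesian product $G\square H$ has vertex set $V(G)\times V(H)$, with $(g_1,h_1)$ and $(g_2,h_2)$ adjacent iff either $g_1=g_2$ and $h_1h_2\in E(H)$, or $g_1g_2\in E(G)$ and $h_1=h_2$. $K_n^d$ (the Hamming graph of dimension $d$) is the Cartesian product of $d$ copies of $K_n$; $K_n^0$ is the graph with a single vertex. The $r$-edge bootstrap percolation process on a graph $G$ (for an integer $r\geqslant 0$) starts with a set $E_0\subseteq E(G)$ of initially active edges; for each $i\geqslant 1$, $E_i$ is the union of $E_{i-1}$ and the set of all edges $e\in E(G)\setminus E_{i-1}$ having an endpoint that is incident to at least $r$ edges of $E_{i-1}$. (Equivalently, $e$ is activated if it completes a copy in $G$ of the star $S_{r+1}$ with $r+1$ edges all of whose other edges are active.) The set $E_0$ is percolating if $E_t=E(G)$ for some $t\geqslant 0$. $m_e(G,r)$ is the minimum size of a percolating set in this process. Conventions: a sum whose upper limit is smaller than its lower limit is $0$; $\binom{a}{b}=0$ if $b<0$ or $b>a\geqslant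 0$. For $n=2$ the formula has only the single summation index $i_1$ and the product of binomials is $\binom{d}{i_1}$. *)

theory Defs
  imports Complex_Main
begin

record 'a ugraph =
  verts :: "'a set"
  edges :: "'a set set"

definition simple_graph :: "'a ugraph \<Rightarrow> bool" where
  "simple_graph G \<longleftrightarrow> finite (verts G) \<and>
     (\<forall>e\<in>edges G. e \<subseteq> verts G \<and> card e = 2)"

definition complete_graph :: "nat \<Rightarrow> nat ugraph" where
  "complete_graph n =
     \<lparr> verts = {..<n}, edges = {{u, v} | u v. u < n \<and> v < n \<and> u \<noteq> v} \<rparr>"

definition cartesian_product :: "'a ugraph \<Rightarrow> 'b ugraph \<Rightarrow> ('a \<times> 'b) ugraph" where
  "cartesian_product G H =
     \<lparr> verts = verts G \<times> verts H,
       edges = {{(g1, h1), (g2, h2)} | g1 h1 g2 h2.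
         (g1, h1) \<in> verts G \<times> verts H \<and> (g2, h2) \<in> verts G \<times> verts H \<and>
         (g1 = g2 \<and> {h1, h2} \<in> edges H \<or> {g1, g2} \<in> edges G \<and> h1 = h2)} \<rparr>"

definition relabel :: "('a \<Rightarrow> 'b) \<Rightarrow> 'a ugraph \<Rightarrow> 'b ugraph" where
  "relabel f G = \<lparr> verts = f ` verts G, edges = (\<lambda>e. f ` e) ` edges G \<rparr>"

text \<open>The nested pairs arising from iterating the Cartesian product are relabelled
  (injectively) as lists, so that the vertex type does not depend on the dimension \<open>d\<close>.\<close>

fun hamming_graph :: "nat \<Rightarrow> nat \<Rightarrow> nat list ugraph" where
  "hamming_graph n 0 = \<lparr> verts = {[]}, edges = {} \<rparr>"
| "hamming_graph n (Suc d) =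
     relabel (\<lambda>(x, xs). x # xs) (cartesian_product (complete_graph n) (hamming_graph n d))"

fun active_edges :: "'a ugraph \<Rightarrow> nat \<Rightarrow> 'a set set \<Rightarrow> nat \<Rightarrow> 'a set set" where
  "active_edges G r E0 0 = E0"
| "active_edges G r E0 (Suc i) = active_edges G r E0 i \<union>
     {e \<in> edges G - active_edges G r E0 i.
        \<exists>v\<in>e. r \<le> card {f \<in> active_edges G r E0 i. v \<in> f}}"

definition percolating :: "'a ugraph \<Rightarrow> nat \<Rightarrow> 'a set set \<Rightarrow> bool" where
  "percolating G r E0 \<longleftrightarrow> E0 \<subseteq> edges G \<and> (\<exists>t. active_edges G r E0 t = edges G)"

text \<open>The minimum exists for every finite graph, since \<open>edges G\<close> itself percolates.\<close>

definition m_e :: "'a ugraph \<Rightarrow> nat \<Rightarrow> nat" where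
  "m_e G r = Min (card ` {E0. percolating G r E0})"

text \<open>With \<open>js = [i\<^sub>1, \<dots>, i\<^sub>l]\<close> the indices already chosen, \<open>nested_sum r f k js\<close> sums
  \<open>f [i\<^sub>1, \<dots>, i\<^sub>l\<^sub>+\<^sub>k]\<close> over the remaining \<open>k\<close> indices, each
  \<open>i\<^sub>j\<close> running from \<open>0\<close> to \<open>r - i\<^sub>1 - \<dots> - i\<^sub>j\<^sub>-\<^sub>1 - 1\<close>. If that upper limit is \<open>-1\<close>, the
  range \<open>{..<0}\<close> is empty; starting from \<open>js = []\<close>, it is never smaller.\<close>

fun nested_sum :: "nat \<Rightarrow> (nat list \<Rightarrow> nat) \<Rightarrow> nat \<Rightarrow> nat list \<Rightarrow> nat" where
  "nested_sum r f 0 js = f js"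
| "nested_sum r f (Suc k) js = (\<Sum>i<r - sum_list js. nested_sum r f k (js @ [i]))"

text \<open>For \<open>js = [i\<^sub>1, \<dots>, i\<^sub>l]\<close> this is
  \<open>(d choose i\<^sub>1) * (i\<^sub>1 choose i\<^sub>2) * \<dots> * (i\<^sub>l\<^sub>-\<^sub>1 choose i\<^sub>l)\<close>.\<close>

definition binomial_chain :: "nat \<Rightarrow> nat list \<Rightarrow> nat" where
  "binomial_chain d js = (\<Prod>j<length js. ((d # js) ! j) choose (js ! j))"

lemma simple_graph_complete_graph: "simple_graph (complete_graph n)"
  by (auto simp: simple_graph_def complete_graph_def)

lemma simple_graph_cartesian_product:
  assumes "simple_graph G" and "simple_graph H"
  shows "simple_graph (cartesian_product G H)"
proof -
  have "g1 \<noteq> g2" if "{g1, g2} \<in> edges G" for g1 g2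
    using that assms(1) by (auto simp: simple_graph_def)
  moreover have "h1 \<noteq> h2" if "{h1, h2} \<in> edges H" for h1 h2
    using that assms(2) by (auto simp: simple_graph_def)
  ultimately show ?thesis
    using assms by (auto simp: simple_graph_def cartesian_product_def card_insert_if)
qed

lemma simple_graph_relabel:
  assumes "simple_graph G" and "inj_on f (verts G)"
  shows "simple_graph (relabel f G)"
  using assms by (auto simp: simple_graph_def relabel_def card_image inj_on_subset)

lemma simple_graph_hamming_graph: "simple_graph (hamming_graph n d)"
proof (induction d)
  case 0
  show ?case by (simp add: simple_graph_def)
next
  case (Suc d)
  then show ?case
    by (auto intro!: simple_graph_relabel simple_graph_cartesian_product
        simple_graph_complete_graph simp: inj_on_def)
qed

end

theory Submission
  imports Defs "HOL-Computational_Algebra.Polynomial"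
begin

text \<open>
  A vertex of the Hamming graph is a word \<open>x\<close> of length \<open>d\<close> over \<open>{0, \<dots>, n - 1}\<close>; write \<open>|x|\<close> for the
  sum of its letters. The index \<open>i\<^sub>j\<close> of the nested sum can be read as the number of positions
  at which a word has a letter \<open>\<ge> j\<close>: the product of binomials then counts the words with
  given \<open>i\<^sub>1, \<dots>, i\<^sub>n\<^sub>-\<^sub>1\<close>, and \<open>i\<^sub>1 + \<dots> + i\<^sub>n\<^sub>-\<^sub>1\<close> is \<open>|x|\<close>. Hence the right-hand side equals
  \<open>N = (\<Sum>x. r - |x|)\<close> with truncated subtraction, the sum running over all words
  (\<open>nested_sum_eq_sum_words\<close>). This is the form in which both bounds appear.

  Upper bound (\<open>exists_percolating_set\<close>). At \<open>x\<close>, exactly \<open>|x|\<close> edges decrease a letter, so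
  \<open>(n - 1) * d - |x| \<ge> r - |x|\<close> edges increase one. Let every \<open>x\<close> contribute \<open>r - |x|\<close>
  of its increasing edges. Going through the words by increasing \<open>|x|\<close>, the decreasing edges at \<open>x\<close>
  are active because they are incident to smaller words; together with the contributed edges
  they are at least \<open>r\<close> many, so the whole star at \<open>x\<close> becomes active.

  Lower bound (\<open>percolating_set_card_ge\<close>). It suffices to find an \<open>N\<close>-dimensional real vector space
  of edge functions in which a function vanishing on \<open>r\<close> edges at a vertex vanishes
  on all edges at that vertex. A function vanishing on a percolating set is then zero, and if that
  set had fewer than \<open>N\<close> edges, linear algebra would give a nonzero such function.
  To get the local property, attach to every vertex \<open>x\<close> a real
  polynomial \<open>P\<^sub>x\<close> of degree \<open>< r\<close>, and to every edge a real label such that the labels at a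
  common vertex are distinct; the function takes at an edge the value of \<open>P\<^sub>x\<close> at its label. This
  requires that the polynomials at the two ends of an edge agree at its label. For the labels
  \<open>2 * n * i + a + b\<close>, where the edge exchanges the letters \<open>a\<close> and \<open>b\<close> at position \<open>i\<close>, such
  compatible families are generated over the polynomial ring by one family for each word \<open>v\<close>,
  of degree at most \<open>|v|\<close> (\<open>basis_poly\<close>). Multiplying it by \<open>t\<^sup>k\<close> with \<open>k < r - |v|\<close> gives \<open>r - |v|\<close>
  families of degree \<open>< r\<close>, hence \<open>N\<close> in total, and a triangularity argument shows
  that they are linearly independent.

  The compatible families form the ring that describes the torus-equivariant cohomology of a
  product of projective spaces by restriction to its fixed points, specialised to one variable, and
  the generators play the role of Schubert classes; this is where the formulas come from.
\<close>

section \<open>The nested sum as a sum over words\<close>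

definition words :: "nat \<Rightarrow> nat \<Rightarrow> nat list set" where
  "words n d = {xs. length xs = d \<and> set xs \<subseteq> {..<n}}"

lemma words_0 [simp]: "words n 0 = {[]}"
  by (auto simp: words_def)

lemma Cons_in_words [simp]: "x # xs \<in> words n (Suc d) \<longleftrightarrow> x < n \<and> xs \<in> words n d"
  by (auto simp: words_def)

lemma words_Suc: "words n (Suc d) = (\<lambda>(x, xs). x # xs) ` ({..<n} \<times> words n d)"
  by (auto simp: words_def length_Suc_conv image_iff)

lemma finite_words [simp]: "finite (words n d)"
  by (induction d) (auto simp: words_Suc)

lemma sum_words_Suc:
  "(\<Sum>w\<in>words n (Suc d). h w) = (\<Sum>a<n. \<Sum>w\<in>words n d. h (a # w))"
proof -
  have "inj_on (\<lambda>(x, xs). x # xs) ({..<n} \<times> words n d)"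
    by (auto simp: inj_on_def)
  then show ?thesis
    by (simp add: words_Suc sum.reindex sum.cartesian_product case_prod_unfold)
qed

lemma nth_word_less: "x \<in> words n d \<Longrightarrow> i < d \<Longrightarrow> x ! i < n"
  by (metis (mono_tags, lifting) lessThan_iff mem_Collect_eq nth_mem subsetD words_def)

lemma length_word: "x \<in> words n d \<Longrightarrow> length x = d"
  by (simp add: words_def)

text \<open>
  A word is determined by the set of positions carrying a nonzero letter and by the shorter word
  of these letters, each lowered by one. Summing over the number \<open>i\<close> of such positions peels off one
  letter of the alphabet, which is what one index of the nested sum does.
\<close>

lemma sum_words_layers:
  fixes h :: "nat \<Rightarrow> nat"
  shows "(\<Sum>w\<in>words (Suc n) d. h (sum_list w)) =
    (\<Sum>i\<le>d. (d choose i) * (\<Sum>w\<in>words n i. h (i + sum_list w)))"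
proof (induction d arbitrary: h)
  case 0
  show ?case by simp
next
  case (Suc d)
  define T where "T i = (\<Sum>w\<in>words n i. h (i + sum_list w))" for i
  have pos: "(\<Sum>a<n. \<Sum>w\<in>words n i. h (Suc (a + (i + sum_list w)))) = T (Suc i)" for i
    by (simp add: T_def sum_words_Suc add_ac)
  have shift: "(\<Sum>a<n. \<Sum>i\<le>d. (d choose i) * (\<Sum>w\<in>words n i. h (Suc a + (i + sum_list w)))) =
      (\<Sum>i\<le>d. (d choose i) * T (Suc i))"
    by (subst sum.swap) (simp add: pos flip: sum_distrib_left)
  have "(\<Sum>w\<in>words (Suc n) (Suc d). h (sum_list w)) =
      (\<Sum>a<Suc n. \<Sum>i\<le>d. (d choose i) * (\<Sum>w\<in>words n i. h (a + (i + sum_list w))))"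
    using Suc.IH[of "\<lambda>s. h (a + s)" for a] by (simp add: sum_words_Suc)
  also have "\<dots> = (\<Sum>i\<le>d. (d choose i) * T i) + (\<Sum>i\<le>d. (d choose i) * T (Suc i))"
    unfolding sum.lessThan_Suc_shift shift by (simp add: T_def)
  also have "(\<Sum>i\<le>d. (d choose i) * T i) = T 0 + (\<Sum>i\<le>d. (d choose Suc i) * T (Suc i))"
    using sum.atMost_Suc_shift[of "\<lambda>i. (d choose i) * T i" d] by (simp add: binomial_eq_0)
  also have "T 0 + (\<Sum>i\<le>d. (d choose Suc i) * T (Suc i)) + (\<Sum>i\<le>d. (d choose i) * T (Suc i)) =
      (\<Sum>i\<le>Suc d. (Suc d choose i) * T i)"
    unfolding sum.atMost_Suc_shift by (simp add: sum.distrib algebra_simps)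
  finally show ?case
    by (simp add: T_def)
qed

text \<open>
  Once \<open>js = [i\<^sub>1, \<dots>, i\<^sub>l]\<close> has been chosen, it remains to sum over the words of length \<open>i\<^sub>l\<close> that
  record the letters \<open>\<ge> l\<close>, each lowered by \<open>l\<close>; the last entry of \<open>d # js\<close> is that length, also for \<open>l = 0\<close>.
\<close>

lemma nested_sum_eq_sum_words:
  "nested_sum r (\<lambda>js. (r - sum_list js) * binomial_chain d js) k js =
    binomial_chain d js * (\<Sum>w\<in>words (Suc k) (last (d # js)). r - (sum_list js + sum_list w))"
proof (induction k arbitrary: js)
  case 0
  have "words (Suc 0) m = {replicate m 0}" for m
    by (auto simp: words_def intro: replicate_eqI)
  then show ?case
    by (simp add: mult.commute sum_list_replicate)
next
  case (Suc k)
  define m where "m = last (d # js)"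
  define T where "T i = (\<Sum>w\<in>words (Suc k) i. r - (sum_list js + (i + sum_list w)))" for i
  have last: "((d # js) ! length js) = m"
    by (simp add: m_def last_conv_nth)
  have "(d # js @ [i]) ! j = (d # js) ! j" if "j \<le> length js" for i j
    using that nth_append_left[of j "d # js" "[i]"] by simp
  then have "binomial_chain d (js @ [i]) = binomial_chain d js * (m choose i)" for i
    by (simp add: binomial_chain_def nth_append last)
  then have "nested_sum r (\<lambda>js. (r - sum_list js) * binomial_chain d js) (Suc k) js =
      binomial_chain d js * (\<Sum>i<r - sum_list js. (m choose i) * T i)"
    by (simp add: Suc.IH T_def sum_distrib_left add_ac mult.assoc)
  \<comment> \<open>The two ranges differ only in zero terms: \<open>T i = 0\<close> for large \<open>i\<close> by truncated subtraction, and
    \<open>m choose i = 0\<close> for \<open>i > m\<close>.\<close>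
  also have "(\<Sum>i<r - sum_list js. (m choose i) * T i) = (\<Sum>i\<le>m. (m choose i) * T i)"
    by (rule sum.mono_neutral_cong) (auto simp: T_def not_less)
  also have "\<dots> = (\<Sum>w\<in>words (Suc (Suc k)) m. r - (sum_list js + sum_list w))"
    using sum_words_layers[of "\<lambda>s. r - (sum_list js + s)" "Suc k" m] by (simp add: T_def)
  finally show ?case
    by (simp add: m_def)
qed

section \<open>Edges and stars of the Hamming graph\<close>

definition moves :: "nat \<Rightarrow> nat list \<Rightarrow> (nat \<times> nat) set" where
  "moves n x = (SIGMA i:{..<length x}. {..<n} - {x ! i})"

definition edge_at :: "nat list \<Rightarrow> nat \<times> nat \<Rightarrow> nat list set" where
  "edge_at x = (\<lambda>(i, b). {x, x[i := b]})"

lemma update_in_words: "x \<in> words n d \<Longrightarrow> (i, b) \<in> moves n x \<Longrightarrow> x[i := b] \<in> words n d"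
  by (auto simp: words_def moves_def dest: set_update_subset_insert[THEN subsetD])

lemma verts_hamming_graph: "verts (hamming_graph n d) = words n d"
  by (induction d)
    (auto simp: relabel_def cartesian_product_def complete_graph_def words_Suc)

lemma edges_hamming_graph_Suc:
  "edges (hamming_graph n (Suc d)) =
    {{a # xs, b # ys} | a b xs ys. a < n \<and> b < n \<and> xs \<in> words n d \<and> ys \<in> words n d \<and>
       (a = b \<and> {xs, ys} \<in> edges (hamming_graph n d) \<or> a \<noteq> b \<and> xs = ys)}" (is "_ = ?R")
proof -
  have K: "{u, v} \<in> edges (complete_graph n) \<longleftrightarrow> u < n \<and> v < n \<and> u \<noteq> v" for u v
    by (auto simp: complete_graph_def doubleton_eq_iff)
  have V: "verts (complete_graph n) = {..<n}"
    by (simp add: complete_graph_def)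
  define S where "S = {{(a, xs), (b, ys)} | a xs b ys.
      (a, xs) \<in> {..<n} \<times> words n d \<and> (b, ys) \<in> {..<n} \<times> words n d \<and>
      (a = b \<and> {xs, ys} \<in> edges (hamming_graph n d) \<or> (a < n \<and> b < n \<and> a \<noteq> b) \<and> xs = ys)}"
  have "edges (hamming_graph n (Suc d)) = (`) (\<lambda>(x, xs). x # xs) ` S"
    by (simp add: relabel_def cartesian_product_def K V verts_hamming_graph S_def)
  also have "\<dots> = ?R"
  proof (intro equalityI subsetI)
    fix e assume "e \<in> ?R"
    then obtain a b xs ys where "e = (\<lambda>(x, xs). x # xs) ` {(a, xs), (b, ys)}"
      and "a < n" "b < n" "xs \<in> words n d" "ys \<in> words n d"
        "a = b \<and> {xs, ys} \<in> edges (hamming_graph n d) \<or> a \<noteq> b \<and> xs = ys"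
      by auto
    moreover from this have "{(a, xs), (b, ys)} \<in> S"
      unfolding S_def by blast
    ultimately show "e \<in> (`) (\<lambda>(x, xs). x # xs) ` S"
      by blast
  next
    fix e assume "e \<in> (`) (\<lambda>(x, xs). x # xs) ` S"
    then obtain a b xs ys where "e = {a # xs, b # ys}"
      and "a < n" "b < n" "xs \<in> words n d" "ys \<in> words n d"
        "a = b \<and> {xs, ys} \<in> edges (hamming_graph n d) \<or> a \<noteq> b \<and> xs = ys"
      unfolding S_def by fastforce
    then show "e \<in> ?R"
      by blast
  qed
  finally show ?thesis .
qed

lemma edges_hamming_graph:
  "edges (hamming_graph n d) = (\<Union>x\<in>words n d. edge_at x ` moves n x)"
proof (induction d)
  case 0
  show ?case by (simp add: moves_def)
next
  case (Suc d)
  show ?case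
  proof (intro equalityI subsetI)
    fix e assume "e \<in> edges (hamming_graph n (Suc d))"
    then obtain a b xs ys where e: "e = {a # xs, b # ys}" and ab: "a < n" "b < n"
      and xs: "xs \<in> words n d" and
      or: "a = b \<and> {xs, ys} \<in> edges (hamming_graph n d) \<or> a \<noteq> b \<and> xs = ys"
      unfolding edges_hamming_graph_Suc by blast
    from or show "e \<in> (\<Union>x\<in>words n (Suc d). edge_at x ` moves n x)"
    proof (elim disjE conjE)
      assume [simp]: "a = b" and "{xs, ys} \<in> edges (hamming_graph n d)"
      then obtain z i c where z: "z \<in> words n d" "(i, c) \<in> moves n z"
        and eq: "{xs, ys} = {z, z[i := c]}"
        unfolding Suc.IH by (auto simp: edge_at_def)
      have "e = edge_at (a # z) (Suc i, c)"
        using eq by (auto simp: e edge_at_def doubleton_eq_iff)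
      moreover have "(Suc i, c) \<in> moves n (a # z)"
        using z by (auto simp: moves_def)
      ultimately show ?thesis
        using z ab by (meson Cons_in_words UN_I image_eqI)
    next
      assume "a \<noteq> b" "xs = ys"
      then have "e = edge_at (a # xs) (0, b)" "(0, b) \<in> moves n (a # xs)"
        using ab by (auto simp: e edge_at_def moves_def)
      then show ?thesis
        using xs ab by (meson Cons_in_words UN_I image_eqI)
    qed
  next
    fix e assume "e \<in> (\<Union>x\<in>words n (Suc d). edge_at x ` moves n x)"
    then obtain a xs i b where x: "a < n" "xs \<in> words n d" and m: "(i, b) \<in> moves n (a # xs)"
      and e: "e = edge_at (a # xs) (i, b)"
      by (auto simp: words_Suc)
    show "e \<in> edges (hamming_graph n (Suc d))"
    proof (cases i)
      case 0
      then show ?thesis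
        unfolding edges_hamming_graph_Suc using x m e by (auto simp: edge_at_def moves_def)
    next
      case (Suc j)
      have j: "(j, b) \<in> moves n xs"
        using m Suc by (auto simp: moves_def)
      have "xs[j := b] \<in> words n d"
        using update_in_words[OF x(2) j] .
      moreover have "{xs, xs[j := b]} \<in> edges (hamming_graph n d)"
        unfolding Suc.IH using x j by (force simp: edge_at_def)
      ultimately show ?thesis
        unfolding edges_hamming_graph_Suc using x e Suc by (auto simp: edge_at_def)
    qed
  qed
qed

lemma edge_at_reverse:
  assumes "x \<in> words n d" and "(i, b) \<in> moves n x"
  shows "edge_at (x[i := b]) (i, x ! i) = edge_at x (i, b)"
    and "(i, x ! i) \<in> moves n (x[i := b])"
  using assms by (auto simp: edge_at_def moves_def length_word nth_word_less)

lemma inj_on_edge_at: "inj_on (edge_at x) (moves n x)"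
proof (rule inj_onI, clarify)
  fix i b j c
  assume "(i, b) \<in> moves n x" "(j, c) \<in> moves n x" "edge_at x (i, b) = edge_at x (j, c)"
  then have *: "i < length x" "b \<noteq> x ! i" "x[i := b] = x[j := c]"
    by (auto simp: moves_def edge_at_def doubleton_eq_iff)
  then have "x[j := c] ! i = b"
    by (metis nth_list_update_eq)
  then show "i = j \<and> b = c"
    using * by (metis nth_list_update_eq nth_list_update_neq)
qed

lemma edge_at_cases:
  assumes "x \<in> words n d" "p \<in> moves n x" "y \<in> edge_at x p"
  obtains q where "q \<in> moves n y" "y \<in> words n d" "edge_at x p = edge_at y q"
proof (cases p)
  case (Pair i b)
  then have "y = x \<or> y = x[i := b]"
    using assms(3) by (auto simp: edge_at_def)
  then show ?thesis
    using that assms edge_at_reverse update_in_words unfolding Pair by metis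
qed

lemma star_hamming_graph:
  assumes "x \<in> words n d"
  shows "{e \<in> edges (hamming_graph n d). x \<in> e} = edge_at x ` moves n x"
  using assms by (auto simp: edges_hamming_graph elim: edge_at_cases) (auto simp: edge_at_def)

section \<open>A percolating set of the claimed size\<close>

definition up_moves :: "nat \<Rightarrow> nat list \<Rightarrow> (nat \<times> nat) set" where
  "up_moves n x = (SIGMA i:{..<length x}. {x ! i<..<n})"

definition down_moves :: "nat list \<Rightarrow> (nat \<times> nat) set" where
  "down_moves x = (SIGMA i:{..<length x}. {..<x ! i})"

lemma finite_moves [simp]: "finite (moves n x)" "finite (up_moves n x)" "finite (down_moves x)"
  by (auto simp: moves_def up_moves_def down_moves_def)

lemma moves_split:
  assumes "x \<in> words n d"
  shows "moves n x = down_moves x \<union> up_moves n x" "down_moves x \<inter> up_moves n x = {}"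
proof -
  have "x ! i < n" if "i < length x" for i
    using assms that by (simp add: nth_word_less length_word)
  then show "moves n x = down_moves x \<union> up_moves n x" "down_moves x \<inter> up_moves n x = {}"
    by (fastforce simp: moves_def down_moves_def up_moves_def)+
qed

lemma card_down_moves: "card (down_moves x) = sum_list x"
  by (simp add: down_moves_def sum_list_sum_nth atLeast0LessThan)

lemma card_moves:
  assumes "x \<in> words n d"
  shows "card (moves n x) = (n - 1) * d"
proof -
  have "x ! i < n" if "i < d" for i
    using assms that by (rule nth_word_less)
  moreover have "length x = d"
    using assms by (simp add: words_def)
  ultimately show ?thesis
    by (simp add: moves_def)
qed

lemma card_up_moves:
  assumes "x \<in> words n d"
  shows "card (up_moves n x) = (n - 1) * d - sum_list x"
  using card_Un_disjoint[OF finite_moves(3) finite_moves(2) moves_split(2)[OF assms]]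
  by (simp add: card_moves[OF assms] card_down_moves flip: moves_split(1)[OF assms])

lemma active_edges_mono: "i \<le> j \<Longrightarrow> active_edges G r E0 i \<subseteq> active_edges G r E0 j"
  by (induction rule: dec_induct) auto

lemma active_edges_subset: "E0 \<subseteq> edges G \<Longrightarrow> active_edges G r E0 i \<subseteq> edges G"
  by (induction i) auto

text \<open>
  Every word \<open>x\<close> contributes a set \<open>U x\<close> of increasing moves. The claim \<open>stars\<close> is the induction
  along the letter sum: after \<open>w\<close> rounds the stars of all words of letter sum below \<open>w\<close> are active.
\<close>

lemma exists_percolating_set:
  assumes "r \<le> (n - 1) * d"
  obtains E0 where "percolating (hamming_graph n d) r E0"
    and "card E0 \<le> (\<Sum>x\<in>words n d. r - sum_list x)"
proof -
  let ?H = "hamming_graph n d"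
  have "\<exists>U. U \<subseteq> up_moves n x \<and> card U = r - sum_list x" if "x \<in> words n d" for x
    using obtain_subset_with_card_n[of "r - sum_list x" "up_moves n x"] card_up_moves[OF that] assms
    by (metis diff_le_mono)
  then obtain U where U: "\<And>x. x \<in> words n d \<Longrightarrow> U x \<subseteq> up_moves n x"
      "\<And>x. x \<in> words n d \<Longrightarrow> card (U x) = r - sum_list x"
    by metis
  define E0 where "E0 = (\<Union>x\<in>words n d. edge_at x ` U x)"
  let ?A = "active_edges ?H r E0"
  have "card E0 \<le> (\<Sum>x\<in>words n d. card (edge_at x ` U x))"
    unfolding E0_def by (rule card_UN_le) simp
  also have "\<dots> \<le> (\<Sum>x\<in>words n d. r - sum_list x)"
    by (intro sum_mono) (metis U card_image_le finite_moves(2) finite_subset)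
  finally have card: "card E0 \<le> (\<Sum>x\<in>words n d. r - sum_list x)" .
  have E0: "E0 \<subseteq> edges ?H"
    using U(1) moves_split(1) by (fastforce simp: E0_def edges_hamming_graph)
  have stars: "edge_at x ` moves n x \<subseteq> ?A w" if "x \<in> words n d" "sum_list x < w" for x w
    using that
  proof (induction w arbitrary: x)
    case 0
    then show ?case by simp
  next
    case (Suc w)
    have len: "length x = d"
      using Suc.prems by (simp add: words_def)
    have "edge_at x p \<in> ?A w" if p: "p \<in> down_moves x" for p
    proof (cases p)
      case (Pair i b)
      have m: "(i, b) \<in> moves n x" and b: "b < x ! i" and i: "i < length x"
        using p Pair moves_split(1)[OF Suc.prems(1)] by (auto simp: down_moves_def)
      have "sum_list (x[i := b]) < sum_list x"
        using b i elem_le_sum_list[of i x] by (simp add: sum_list_update)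
      then have "edge_at (x[i := b]) (i, x ! i) \<in> ?A w"
        using Suc edge_at_reverse[OF Suc.prems(1) m] update_in_words[OF Suc.prems(1) m] by force
      then show ?thesis
        using edge_at_reverse[OF Suc.prems(1) m] Pair by simp
    qed
    moreover have "edge_at x ` U x \<subseteq> ?A w"
      using active_edges_mono[of 0 w ?H r E0] Suc.prems(1) by (auto simp: E0_def)
    ultimately have sub: "edge_at x ` (down_moves x \<union> U x) \<subseteq> {f \<in> ?A w. x \<in> f}"
      by (auto simp: edge_at_def)
    have fin: "finite (U x)"
      using U(1)[OF Suc.prems(1)] by (rule finite_subset) simp
    have disj: "down_moves x \<inter> U x = {}" and subm: "down_moves x \<union> U x \<subseteq> moves n x"
      using U(1)[OF Suc.prems(1)] moves_split[OF Suc.prems(1)] by auto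
    have "card (down_moves x \<union> U x) = sum_list x + (r - sum_list x)"
      using fin disj by (simp add: card_Un_disjoint card_down_moves U(2) Suc.prems(1))
    then have "r \<le> card (edge_at x ` (down_moves x \<union> U x))"
      using inj_on_subset[OF inj_on_edge_at subm] by (simp add: card_image)
    also have "\<dots> \<le> card {f \<in> ?A w. x \<in> f}"
    proof (rule card_mono[OF _ sub])
      have "{f \<in> ?A w. x \<in> f} \<subseteq> edge_at x ` moves n x"
        using active_edges_subset[OF E0, of r w] star_hamming_graph[OF Suc.prems(1)] by blast
      then show "finite {f \<in> ?A w. x \<in> f}"
        by (rule finite_subset) simp
    qed
    finally have "{e \<in> edges ?H. x \<in> e} \<subseteq> ?A (Suc w)"
      by auto
    then show ?case
      unfolding star_hamming_graph[OF Suc.prems(1)] .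
  qed
  define t where "t = Suc (\<Sum>x\<in>words n d. sum_list x)"
  have "sum_list x < t" if "x \<in> words n d" for x
    using member_le_sum[OF that, of sum_list] by (simp add: t_def)
  then have "?A t = edges ?H"
    using stars active_edges_subset[OF E0] by (fastforce simp: edges_hamming_graph)
  with E0 have "percolating ?H r E0"
    by (auto simp: percolating_def)
  then show ?thesis
    using card that by blast
qed

section \<open>Every percolating set has at least the claimed size\<close>

text \<open>
  Gaussian elimination: an equation with a nonzero coefficient at \<open>p\<close> is used to remove the
  unknown \<open>p\<close> from the others, which loses one equation and one unknown.
\<close>

lemma underdetermined_system_nontrivial:
  fixes A :: "'e \<Rightarrow> 'i \<Rightarrow> 'k::field"
  assumes "finite E" "finite I" "card E < card I"
  obtains c where "\<forall>e\<in>E. (\<Sum>i\<in>I. A e i * c i) = 0" "\<exists>i\<in>I. c i \<noteq> 0"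
proof -
  have "\<exists>c. (\<forall>e\<in>E. (\<Sum>i\<in>I. A e i * c i) = 0) \<and> (\<exists>i\<in>I. c i \<noteq> 0)"
    using assms
  proof (induction E arbitrary: A I)
    case empty
    then have "I \<noteq> {}" by auto
    then show ?case by (intro exI[of _ "\<lambda>_. 1"]) auto
  next
    case (insert e E)
    show ?case
    proof (cases "\<forall>i\<in>I. A e i = 0")
      case True
      then show ?thesis
        using insert.IH[of I A] insert.prems insert.hyps by auto
    next
      case False
      then obtain p where p: "p \<in> I" "A e p \<noteq> 0" by auto
      define J where "J = I - {p}"
      have I: "I = insert p J" "p \<notin> J" "finite J"
        using p insert.prems by (auto simp: J_def)
      then have "card E < card J"
        using insert.prems insert.hyps by simp
      then obtain c where c: "\<forall>f\<in>E. (\<Sum>i\<in>J. (A f i - A f p * A e i / A e p) * c i) = 0"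
          "\<exists>i\<in>J. c i \<noteq> 0"
        using insert.IH[of J "\<lambda>f i. A f i - A f p * A e i / A e p"] I by auto
      define c' where "c' = c(p := - (\<Sum>i\<in>J. A e i * c i) / A e p)"
      have sum: "(\<Sum>i\<in>I. A f i * c' i) =
          (\<Sum>i\<in>J. A f i * c i) - A f p * (\<Sum>i\<in>J. A e i * c i) / A e p" for f
      proof -
        have "(\<Sum>i\<in>J. A f i * c' i) = (\<Sum>i\<in>J. A f i * c i)"
          using I by (intro sum.cong) (auto simp: c'_def)
        then show ?thesis
          using I by (simp add: c'_def)
      qed
      have "(\<Sum>i\<in>I. A f i * c' i) = 0" if "f \<in> insert e E" for f
      proof (cases "f = e")
        case True
        then show ?thesis using p by (simp add: sum)
      next
        case False
        then have "(\<Sum>i\<in>J. (A f i - A f p * A e i / A e p) * c i) = 0"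
          using c that by blast
        then show ?thesis
          by (simp add: sum left_diff_distrib sum_subtractf sum_distrib_left sum_divide_distrib mult.assoc)
      qed
      moreover have "\<exists>i\<in>I. c' i \<noteq> 0"
        using c(2) I by (auto simp: c'_def)
      ultimately show ?thesis by blast
    qed
  qed
  then show ?thesis using that by blast
qed

text \<open>
  The summand \<open>2 * n * i\<close> separates positions, since the sum of two distinct letters is
  less than \<open>2 * n\<close>. The rest is symmetric in the two letters, so both ends of an edge give it the
  same label.
\<close>

definition label :: "nat \<Rightarrow> nat list \<Rightarrow> nat \<times> nat \<Rightarrow> real" where
  "label n x = (\<lambda>(i, b). real (2 * n * i + x ! i + b))"

text \<open>
  This is the polynomial, in the variable \<open>t\<close>,
  \<open>\<Prod>i. \<Prod>j<v\<^sub>i. (s\<^sub>i(x\<^sub>i) - s\<^sub>i(j))\<close> for \<open>s\<^sub>i(a) = a * (t - 2 * n * i - a)\<close>. Since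
  \<open>s\<^sub>i(a) - s\<^sub>i(b) = (a - b) * (t - 2 * n * i - a - b)\<close> vanishes exactly at the label of the edges that
  exchange \<open>a\<close> and \<open>b\<close> at position \<open>i\<close>, and the product depends on \<open>x\<^sub>i\<close> only through
  \<open>s\<^sub>i(x\<^sub>i)\<close>, it agrees at the two ends of an edge when evaluated at the label. The product over \<open>j\<close>
  is the Newton basis for interpolation in the points \<open>s\<^sub>i(0), s\<^sub>i(1), \<dots>\<close>, which is why the family
  is triangular.
\<close>

definition basis_poly :: "nat \<Rightarrow> nat list \<Rightarrow> nat list \<Rightarrow> real poly" where
  "basis_poly n v x = (\<Prod>i<length v. \<Prod>j<v ! i.
     smult (real (x ! i) - real j) [:- real (2 * n * i + x ! i + j), 1:])"

lemma inj_on_label: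
  assumes "x \<in> words n d"
  shows "inj_on (label n x) (moves n x)"
proof (rule inj_onI, clarify)
  fix i b j c
  assume m: "(i, b) \<in> moves n x" "(j, c) \<in> moves n x" and "label n x (i, b) = label n x (j, c)"
  then have eq: "2 * n * i + (x ! i + b) = 2 * n * j + (x ! j + c)"
    unfolding label_def by (metis (mono_tags, lifting) add.assoc case_prod_conv of_nat_eq_iff)
  have "x ! k < n" if "k < length x" for k
    using assms that by (simp add: nth_word_less length_word)
  then have "x ! i + b < 2 * n" "x ! j + c < 2 * n"
    using m by (fastforce simp: moves_def)+
  then have "i = j"
    using eq by (metis add_cancel_right_right div_less div_mult_self4 nat_less_le not_less_zero)
  then show "i = j \<and> b = c"
    using eq by simp
qed

lemma label_reverse:
  assumes "(i, b) \<in> moves n x"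
  shows "label n (x[i := b]) (i, x ! i) = label n x (i, b)"
  using assms by (simp add: label_def moves_def)

text \<open>
  At \<open>t = 2 * n * i + a + b\<close> the factor of index \<open>i, j\<close> is \<open>(a - j) * (b - j)\<close>, which is symmetric in
  the two letters \<open>a\<close> and \<open>b\<close>; the factors of the other positions are the same at both ends.
\<close>

lemma poly_basis_poly_reverse:
  assumes "(i, b) \<in> moves n x"
  shows "poly (basis_poly n v (x[i := b])) (label n x (i, b)) =
    poly (basis_poly n v x) (label n x (i, b))"
proof -
  have "i < length x"
    using assms by (simp add: moves_def)
  then show ?thesis
    unfolding basis_poly_def poly_prod
    by (intro prod.cong refl) (auto simp: label_def nth_list_update algebra_simps)
qed

lemma degree_basis_poly: "degree (basis_poly n v x) \<le> sum_list v"
proof -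
  have "degree (\<Prod>j<v ! i. smult (real (x ! i) - real j) [:- real (2 * n * i + x ! i + j), 1:])
      \<le> (\<Sum>j<v ! i. 1)" for i
    by (rule order.trans[OF degree_prod_sum_le sum_mono])
      (auto intro: order.trans[OF degree_smult_le])
  then have "degree (basis_poly n v x) \<le> (\<Sum>i<length v. \<Sum>j<v ! i. 1)"
    unfolding basis_poly_def by (intro order.trans[OF degree_prod_sum_le sum_mono]) auto
  then show ?thesis
    by (simp add: sum_list_sum_nth atLeast0LessThan)
qed

lemma basis_poly_diagonal: "basis_poly n v v \<noteq> 0"
  by (simp add: basis_poly_def)

text \<open>
  The letter sums force \<open>x\<^sub>i < v\<^sub>i\<close> at some position \<open>i\<close>, and then the factor with \<open>j = x\<^sub>i\<close> is zero.
  Together with \<open>basis_poly_diagonal\<close> this is the triangularity of the family with respect to the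
  letter sum.
\<close>

lemma basis_poly_eq_0:
  assumes "length v = length x" "v \<noteq> x" "sum_list x \<le> sum_list v"
  shows "basis_poly n v x = 0"
proof -
  have "\<exists>i<length v. x ! i < v ! i"
  proof (rule ccontr)
    assume "\<not> ?thesis"
    then have le: "v ! i \<le> x ! i" if "i < length v" for i
      using that by (meson not_le)
    moreover obtain k where "k < length v" "v ! k \<noteq> x ! k"
      using assms by (meson nth_equalityI)
    ultimately have "(\<Sum>i<length v. v ! i) < (\<Sum>i<length v. x ! i)"
      by (intro sum_strict_mono_ex1) (auto simp: le_neq_implies_less intro!: bexI[of _ k])
    then show False
      using assms by (simp add: sum_list_sum_nth atLeast0LessThan)
  qed
  then show ?thesis
    by (force simp: basis_poly_def)
qed

lemma active_edges_subset_closed: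
  assumes "E0 \<subseteq> Z"
    and "\<And>v e. e \<in> edges G \<Longrightarrow> v \<in> e \<Longrightarrow> r \<le> card {f \<in> edges G \<inter> Z. v \<in> f} \<Longrightarrow> e \<in> Z"
    and "E0 \<subseteq> edges G" and "finite (edges G)"
  shows "active_edges G r E0 i \<subseteq> Z"
proof (induction i)
  case 0
  then show ?case using assms by simp
next
  case (Suc i)
  have "card {f \<in> active_edges G r E0 i. v \<in> f} \<le> card {f \<in> edges G \<inter> Z. v \<in> f}" for v
    using Suc active_edges_subset[OF assms(3)] assms(4) by (intro card_mono) auto
  then show ?case
    using Suc assms(2) by simp (blast intro: order.trans)
qed

lemma percolating_set_card_ge:
  assumes r: "r \<le> (n - 1) * d" and perc: "percolating (hamming_graph n d) r E0"
  shows "(\<Sum>x\<in>words n d. r - sum_list x) \<le> card E0"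
proof (rule ccontr)
  let ?H = "hamming_graph n d"
  assume "\<not> ?thesis"
  then have less: "card E0 < (\<Sum>x\<in>words n d. r - sum_list x)" by simp
  \<comment> \<open>The pair \<open>(v, k)\<close> stands for the basis family of \<open>v\<close> multiplied by the \<open>k\<close>-th power of the variable.\<close>
  define I where "I = (SIGMA v:words n d. {..<r - sum_list v})"
  have cardI: "card I = (\<Sum>x\<in>words n d. r - sum_list x)" and finI: "finite I"
    by (simp_all add: I_def)
  have "I \<noteq> {}"
    using less cardI by auto
  then have "0 < r"
    by (auto simp: I_def)
  define Q where "Q x = (\<lambda>(v, k). monom 1 k * basis_poly n v x)" for x
  have E0: "E0 \<subseteq> edges ?H"
    using perc by (simp add: percolating_def)
  have finE: "finite (edges ?H)"
    by (simp add: edges_hamming_graph)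
  \<comment> \<open>The value at an edge does not depend on the end used to compute it, so one end
    \<open>X e\<close> per edge suffices to write down the linear equations for vanishing on \<open>E0\<close>.\<close>
  have "\<exists>x p. x \<in> words n d \<and> p \<in> moves n x \<and> e = edge_at x p" if "e \<in> E0" for e
    using that E0 unfolding edges_hamming_graph by blast
  then obtain X M where XM: "\<And>e. e \<in> E0 \<Longrightarrow> X e \<in> words n d \<and> M e \<in> moves n (X e) \<and> e = edge_at (X e) (M e)"
    by metis
  obtain c where c: "\<forall>e\<in>E0. (\<Sum>q\<in>I. poly (Q (X e) q) (label n (X e) (M e)) * c q) = 0"
      "\<exists>q\<in>I. c q \<noteq> 0"
    using underdetermined_system_nontrivial[of E0 I "\<lambda>e q. poly (Q (X e) q) (label n (X e) (M e))"]
      less cardI finI finite_subset[OF E0 finE] by auto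
  define P where "P x = (\<Sum>q\<in>I. smult (c q) (Q x q))" for x
  have degP: "degree (P x) < r" for x
    unfolding P_def
  proof (rule degree_sum_less[OF _ \<open>0 < r\<close>])
    fix q assume "q \<in> I"
    then obtain v k where q: "q = (v, k)" "k < r - sum_list v"
      by (auto simp: I_def)
    have "degree (Q x q) \<le> k + sum_list v"
      unfolding Q_def q
      using degree_mult_le[of "monom 1 k" "basis_poly n v x"] degree_basis_poly[of n v x]
        degree_monom_le[of "1::real" k] by simp
    then show "degree (smult (c q) (Q x q)) < r"
      using degree_smult_le[of "c q" "Q x q"] q by linarith
  qed
  have P_reverse: "poly (P (x[i := b])) (label n x (i, b)) = poly (P x) (label n x (i, b))"
    if "(i, b) \<in> moves n x" for x i b
    using poly_basis_poly_reverse[OF that] by (simp add: P_def Q_def poly_sum case_prod_unfold)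
  define Z where "Z = {e. \<exists>x\<in>words n d. \<exists>p\<in>moves n x. e = edge_at x p \<and> poly (P x) (label n x p) = 0}"
  have Z_iff: "edge_at x p \<in> Z \<longleftrightarrow> poly (P x) (label n x p) = 0"
    if x: "x \<in> words n d" and p: "p \<in> moves n x" for x p
  proof
    assume "edge_at x p \<in> Z"
    then obtain y i b where y: "y \<in> words n d" "(i, b) \<in> moves n y" "edge_at x p = edge_at y (i, b)"
      and zero: "poly (P y) (label n y (i, b)) = 0"
      by (auto simp: Z_def)
    have "x = y \<or> x = y[i := b]"
      using y(3) by (auto simp: edge_at_def split: prod.splits)
    then show "poly (P x) (label n x p) = 0"
    proof
      assume "x = y"
      then show ?thesis
        using inj_onD[OF inj_on_edge_at[of y n]] p y zero by metis
    next
      assume xy: "x = y[i := b]"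
      then have "edge_at x p = edge_at x (i, y ! i)"
        using edge_at_reverse[OF y(1,2)] y by simp
      then have "p = (i, y ! i)"
        using inj_onD[OF inj_on_edge_at[of x n] _ p] edge_at_reverse(2)[OF y(1,2)] xy by simp
      then show ?thesis
        using zero xy P_reverse[OF y(2)] label_reverse[OF y(2)] by simp
    qed
  qed (use that in \<open>auto simp: Z_def\<close>)
  \<comment> \<open>The distinct labels of \<open>r\<close> edges at \<open>x\<close> would be \<open>r\<close> roots of a polynomial of degree \<open>< r\<close>.\<close>
  have P_0: "P x = 0" if x: "x \<in> words n d" and card: "r \<le> card {f \<in> edges ?H \<inter> Z. x \<in> f}" for x
  proof (rule ccontr)
    assume nz: "P x \<noteq> 0"
    define S where "S = {p \<in> moves n x. edge_at x p \<in> Z}"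
    have "{f \<in> edges ?H \<inter> Z. x \<in> f} = {e \<in> edges ?H. x \<in> e} \<inter> Z"
      by auto
    then have "{f \<in> edges ?H \<inter> Z. x \<in> f} = edge_at x ` S"
      unfolding S_def star_hamming_graph[OF x] by auto
    then have "r \<le> card S"
      using card card_image_le[of S "edge_at x"] by (simp add: S_def)
    also have "card S = card (label n x ` S)"
      using inj_on_subset[OF inj_on_label[OF x]] by (intro card_image[symmetric]) (auto simp: S_def)
    also have "\<dots> \<le> card {t. poly (P x) t = 0}"
      using poly_roots_finite[OF nz] Z_iff[OF x] by (intro card_mono) (auto simp: S_def)
    also have "\<dots> \<le> degree (P x)"
      by (rule card_poly_roots_bound[OF nz])
    finally show False
      using degP[of x] by simp
  qed
  have "E0 \<subseteq> Z"
  proof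
    fix e assume e: "e \<in> E0"
    have "poly (P (X e)) (label n (X e) (M e)) = 0"
      using c(1) e by (simp add: P_def poly_sum mult.commute)
    then show "e \<in> Z"
      using XM[OF e] Z_iff by metis
  qed
  then have "active_edges ?H r E0 t \<subseteq> Z" for t
  proof (rule active_edges_subset_closed[OF _ _ E0 finE])
    fix x e assume e: "e \<in> edges ?H" "x \<in> e" and card: "r \<le> card {f \<in> edges ?H \<inter> Z. x \<in> f}"
    have x: "x \<in> words n d"
      using e simple_graph_hamming_graph[of n d] by (auto simp: simple_graph_def verts_hamming_graph)
    then obtain p where "p \<in> moves n x" "e = edge_at x p"
      using e star_hamming_graph by blast
    then show "e \<in> Z"
      using Z_iff P_0 x card by simp
  qed
  then have "edges ?H \<subseteq> Z"
    using perc by (auto simp: percolating_def)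
  then have "{f \<in> edges ?H \<inter> Z. x \<in> f} = {f \<in> edges ?H. x \<in> f}" for x
    by blast
  then have P_0': "P x = 0" if "x \<in> words n d" for x
    using P_0[OF that] that r by (simp add: star_hamming_graph card_image inj_on_edge_at card_moves)
  \<comment> \<open>It remains to see that the basis families are independent over the polynomial ring. \<open>C v\<close>
    collects the coefficients of the family of \<open>v\<close>; evaluating at the vertex \<open>v\<close> leaves only words of
    smaller letter sum and \<open>v\<close> itself.\<close>
  define C where "C v = (\<Sum>k<r - sum_list v. monom (c (v, k)) k)" for v
  have P_C: "P x = (\<Sum>v\<in>words n d. C v * basis_poly n v x)" for x
    unfolding P_def I_def C_def Q_def sum_distrib_right
    by (simp add: sum.Sigma case_prod_unfold smult_monom flip: mult_smult_left)
  have "C v = 0" if "v \<in> words n d" for v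
    using that
  proof (induction "sum_list v" arbitrary: v rule: less_induct)
    case less
    have "C w * basis_poly n w v = 0" if "w \<in> words n d" "w \<noteq> v" for w
    proof (cases "sum_list w < sum_list v")
      case False
      then show ?thesis
        using basis_poly_eq_0[of w v n] that less.prems by (simp add: words_def)
    qed (use less that in simp)
    then have "(\<Sum>w\<in>words n d - {v}. C w * basis_poly n w v) = 0"
      by (intro sum.neutral) blast
    then have "P v = C v * basis_poly n v v"
      unfolding P_C using less.prems by (simp add: sum.remove)
    then show ?case
      using P_0' less.prems basis_poly_diagonal by simp
  qed
  moreover have "coeff (C v) k = c (v, k)" if "k < r - sum_list v" for v k
    using that by (simp add: C_def coeff_sum if_distrib)
  ultimately have "c q = 0" if "q \<in> I" for q
    using that by (auto simp: I_def) (metis coeff_0)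
  with c(2) show False by blast
qed

section \<open>The minimum size of a percolating set\<close>

theorem theorem1p1:
  fixes n d r :: nat
  assumes "n \<ge> 2" and "r \<le> (n - 1) * d"
  shows "m_e (hamming_graph n d) r =
    nested_sum r (\<lambda>js. (r - sum_list js) * binomial_chain d js) (n - 1) []"
proof -
  let ?N = "\<Sum>x\<in>words n d. r - sum_list x"
  obtain E0 where E0: "percolating (hamming_graph n d) r E0" "card E0 \<le> ?N"
    using exists_percolating_set[OF assms(2)] .
  have "finite {E. percolating (hamming_graph n d) r E}"
    by (rule finite_subset[of _ "Pow (edges (hamming_graph n d))"])
      (auto simp: percolating_def edges_hamming_graph)
  then have "m_e (hamming_graph n d) r = ?N"
    unfolding m_e_def using E0 percolating_set_card_ge[OF assms(2)]
    by (intro Min_eqI) (auto simp: image_iff intro!: exI[of _ E0] le_antisym)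
  also have "\<dots> = nested_sum r (\<lambda>js. (r - sum_list js) * binomial_chain d js) (n - 1) []"
    using assms(1) nested_sum_eq_sum_words[of r d "n - 1" "[]"] by (simp add: binomial_chain_def)
  finally show ?thesis .
qed

end
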